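(* Let $c>0$ and let $f$ be a locally univalent meromorphic function in $\mathbb{D}$ such that $f(0)=0$ and $$\lim_{z\to\xi}\frac{|f'(z)|}{1+|f(z)|^2}=c\quad\text{for all } \xi\in\mathbb{C} \text{ with } |\xi|=1,$$ where the limit is taken over $z\in\mathbb{D}$. Then there is $\eta\in\mathbb{C}$ such that $f(z)=\eta z$ for all $z\in\mathbb{D}$.
   Context: $\mathbb{D}=\{z\in\mathbb{C}:|z|<1\}$. A meromorphic function $f$ in $\mathbb{D}$ is locally univalent if every point of $\mathbb{D}$ has a neighborhood on which $f$, viewed as a map into the Riemann sphere, is injective. The expression $\frac{|f'(z)|}{1+|f(z)|^2}$ is extended continuously to the poles of $f$. *)

theory Defs
  imports "HOL-Complex_Analysis.Complex_Analysis"
begin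

text \<open>
  A meromorphic function is represented by a function \<^term>\<open>f :: complex \<Rightarrow> complex\<close> with
  \<^term>\<open>f nicely_meromorphic_on A\<close>: it is continuous (hence holomorphic) off its poles and, by
  convention, takes the junk value 0 at its poles. Its genuine value in the Riemann sphere,
  modelled as \<^typ>\<open>complex option\<close> with \<^term>\<open>None\<close> as the point at infinity, is
  the following.
\<close>

definition sphere_map :: "(complex \<Rightarrow> complex) \<Rightarrow> complex \<Rightarrow> complex option" where
  "sphere_map f z = (if is_pole f z then None else Some (f z))"

definition locally_univalent_on :: "(complex \<Rightarrow> complex) \<Rightarrow> complex set \<Rightarrow> bool" where
  "locally_univalent_on f A \<longleftrightarrow>
     (\<forall>z\<in>A. \<exists>U. open U \<and> z \<in> U \<and> U \<subseteq> A \<and> inj_on (sphere_map f) U)"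

definition spherical_derivative :: "(complex \<Rightarrow> complex) \<Rightarrow> complex \<Rightarrow> real" where
  "spherical_derivative f z =
     (if is_pole f z
      then Lim (at z) (\<lambda>w. norm (deriv f w) / (1 + (norm (f w))\<^sup>2))
      else norm (deriv f z) / (1 + (norm (f z))\<^sup>2))"

end

theory Submission
  imports Defs
begin

text \<open>
  Put \<open>\<lambda> = |f'| / (1 + |f|\<^sup>2)\<close> for the spherical derivative. Local univalence makes
  \<open>\<lambda>\<close> positive everywhere, also at the poles, and \<open>U = - ln \<lambda>\<close> solves the Liouville equation
  \<open>\<Delta>U = 4 exp (-2 U)\<close> in the disc, because \<open>\<lambda>\<close> is the pull-back of the spherical metric. The
  hypothesis on the boundary says that \<open>U\<close> extends continuously to the closed disc, with a
  constant value on the circle.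

  By the method of moving planes (Gidas, Ni and Nirenberg) such a \<open>U\<close> is radial. It is smaller
  inside than on the circle. Compare \<open>U\<close> on the cap \<open>{Re z \<ge> t}\<close> with its reflection
  across the line \<open>Re z = t\<close>: for \<open>t = 1\<close> the cap is a point, and the inequality
  \<open>U (2 t - cnj z) \<le> U z\<close> persists while \<open>t\<close> decreases to \<open>0\<close>. To decrease \<open>t\<close> a little, the
  inequality at \<open>t\<close> is first improved to a strict one away from the line
  (\<open>dominated_strict\<close>); a strict inequality survives a small change of \<open>t\<close> on a
  compact set, and in the remaining strip the difference is controlled by the
  maximum principle for narrow domains (\<open>narrow_strip\<close>). At the
  circle, these comparisons use the continuity of \<open>U\<close> and its constant value. At \<open>t = 0\<close>, and
  with the disc rotated arbitrarily, one gets the symmetry of \<open>U\<close> in every line through the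
  origin (\<open>liouville_solution_radial\<close>).

  So \<open>\<lambda>\<close> is invariant under rotations. Near \<open>0\<close>, where \<open>f\<close> is holomorphic with \<open>f 0 = 0\<close>, the
  reciprocal \<open>(1 + |f|\<^sup>2)\<^sup>2 / |f'|\<^sup>2\<close> of \<open>\<lambda>\<^sup>2\<close> is a sum of products of holomorphic and
  antiholomorphic functions. Its invariance can therefore be polarised in \<open>z\<close> and \<open>cnj z\<close>;
  setting the second variable to \<open>0\<close> leaves \<open>f' (u z) = f' z\<close> for all \<open>|u| = 1\<close>. Hence \<open>f'\<close> is
  constant near \<open>0\<close>, and \<open>f\<close> is linear on the whole disc by the identity theorem.
\<close>

section \<open>Pointwise Laplacians\<close>

text \<open>
  A Laplacian at a single point, without derivatives: near \<open>z\<close> the function is the real part of a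
  holomorphic function plus \<open>L / 4 * |x - z|\<^sup>2\<close> up to a smaller error. For a \<open>C\<^sup>2\<close>
  function this \<open>L\<close> is the Laplacian. Solutions of the Liouville equation come in
  exactly this form, and minima can be tested by the maximum modulus principle.
\<close>

definition has_laplacian :: "(complex \<Rightarrow> real) \<Rightarrow> real \<Rightarrow> complex \<Rightarrow> bool" where
  "has_laplacian v L z \<longleftrightarrow>
     (\<exists>G r. r > 0 \<and> G holomorphic_on ball z r \<and> v z = Re (G z) \<and>
        ((\<lambda>x. (v x - Re (G x)) / (norm (x - z))\<^sup>2) \<longlongrightarrow> L / 4) (at z))"

lemma has_laplacianI:
  assumes "r > 0" "G holomorphic_on ball z r" "v z = Re (G z)"
    "((\<lambda>x. (v x - Re (G x)) / (norm (x - z))\<^sup>2) \<longlongrightarrow> L / 4) (at z)"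
  shows "has_laplacian v L z"
  using assms unfolding has_laplacian_def by blast

lemma has_laplacian_add:
  assumes "has_laplacian v L z" "has_laplacian w M z"
  shows "has_laplacian (\<lambda>x. v x + w x) (L + M) z"
proof -
  from assms(1) obtain G r where G: "r > 0" "G holomorphic_on ball z r" "v z = Re (G z)"
    "((\<lambda>x. (v x - Re (G x)) / (norm (x - z))\<^sup>2) \<longlongrightarrow> L / 4) (at z)"
    unfolding has_laplacian_def by blast
  from assms(2) obtain H s where H: "s > 0" "H holomorphic_on ball z s" "w z = Re (H z)"
    "((\<lambda>x. (w x - Re (H x)) / (norm (x - z))\<^sup>2) \<longlongrightarrow> M / 4) (at z)"
    unfolding has_laplacian_def by blast
  have "(\<lambda>x. G x + H x) holomorphic_on ball z (min r s)"
    by (intro holomorphic_intros holomorphic_on_subset[OF G(2)] holomorphic_on_subset[OF H(2)]) auto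
  moreover have "((\<lambda>x. (v x + w x - Re (G x + H x)) / (norm (x - z))\<^sup>2) \<longlongrightarrow> (L + M) / 4) (at z)"
    using tendsto_add[OF G(4) H(4)] by (simp add: add_divide_distrib diff_divide_distrib algebra_simps)
  ultimately show ?thesis
    using G(1,3) H(1,3) by (intro has_laplacianI[of "min r s"]) auto
qed

lemma has_laplacian_cmult:
  assumes "has_laplacian v L z"
  shows "has_laplacian (\<lambda>x. m * v x) (m * L) z"
proof -
  from assms(1) obtain G r where G: "r > 0" "G holomorphic_on ball z r" "v z = Re (G z)"
    "((\<lambda>x. (v x - Re (G x)) / (norm (x - z))\<^sup>2) \<longlongrightarrow> L / 4) (at z)"
    unfolding has_laplacian_def by blast
  have "(\<lambda>x. of_real m * G x) holomorphic_on ball z r"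
    by (intro holomorphic_intros G(2))
  moreover have "((\<lambda>x. (m * v x - Re (of_real m * G x)) / (norm (x - z))\<^sup>2) \<longlongrightarrow> (m * L) / 4) (at z)"
    using tendsto_mult_left[OF G(4), of m] by (simp add: right_diff_distrib)
  ultimately show ?thesis
    using G(1,3) by (intro has_laplacianI) auto
qed

lemma has_laplacian_diff:
  assumes "has_laplacian v L z" "has_laplacian w M z"
  shows "has_laplacian (\<lambda>x. v x - w x) (L - M) z"
  using has_laplacian_add[OF assms(1) has_laplacian_cmult[OF assms(2), of "-1"]] by simp

lemma has_laplacian_Re:
  assumes "G holomorphic_on UNIV"
  shows "has_laplacian (\<lambda>x. Re (G x)) 0 z"
  by (rule has_laplacianI[of 1 G]) (auto intro: holomorphic_on_subset[OF assms])

lemma has_laplacian_norm_sq: "has_laplacian (\<lambda>x. (norm x)\<^sup>2) 4 z"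
proof (rule has_laplacianI[of 1 "\<lambda>x. of_real ((norm z)\<^sup>2) + 2 * cnj z * (x - z)"])
  have eq: "(norm x)\<^sup>2 - Re (of_real ((norm z)\<^sup>2) + 2 * cnj z * (x - z)) = (norm (x - z))\<^sup>2" for x
    by (simp add: cmod_power2) (simp add: power2_eq_square algebra_simps)
  have "((\<lambda>x. 1::real) \<longlongrightarrow> 4 / 4) (at z)"
    by simp
  moreover have "\<forall>\<^sub>F x in at z. 1 = ((norm x)\<^sup>2 - Re (of_real ((norm z)\<^sup>2) + 2 * cnj z * (x - z))) / (norm (x - z))\<^sup>2"
    unfolding eq by (auto simp: eventually_at_filter)
  ultimately show "((\<lambda>x. ((norm x)\<^sup>2 - Re (of_real ((norm z)\<^sup>2) + 2 * cnj z * (x - z))) / (norm (x - z))\<^sup>2)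
      \<longlongrightarrow> 4 / 4) (at z)"
    by (rule Lim_transform_eventually)
qed (auto intro!: holomorphic_intros)

lemma has_laplacian_Re_sq: "has_laplacian (\<lambda>x. (Re x - t)\<^sup>2) 2 z"
proof -
  have "has_laplacian (\<lambda>x. (1/2) * (norm x)\<^sup>2 + Re (x\<^sup>2 / 2 - 2 * of_real t * x + of_real (t\<^sup>2))) ((1/2) * 4 + 0) z"
    by (intro has_laplacian_add has_laplacian_cmult has_laplacian_norm_sq has_laplacian_Re holomorphic_intros) auto
  moreover have "(1/2) * (norm x)\<^sup>2 + Re (x\<^sup>2 / 2 - 2 * of_real t * x + of_real (t\<^sup>2)) = (Re x - t)\<^sup>2" for x
    unfolding cmod_power2 by (simp add: power2_eq_square field_simps)
  ultimately show ?thesis by simp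
qed

text \<open>
  If \<open>L\<close> were negative, the real part of the holomorphic function in the expansion would have a
  strict local minimum at \<open>z\<close>.
\<close>

lemma has_laplacian_min_nonneg:
  assumes "has_laplacian v L z" "eventually (\<lambda>x. v z \<le> v x) (at z)"
  shows "L \<ge> 0"
proof (rule ccontr)
  assume "\<not> L \<ge> 0"
  hence L: "L < 0" by simp
  from assms(1) obtain G r where G: "r > 0" "G holomorphic_on ball z r" "v z = Re (G z)"
    "((\<lambda>x. (v x - Re (G x)) / (norm (x - z))\<^sup>2) \<longlongrightarrow> L / 4) (at z)"
    unfolding has_laplacian_def by blast
  have "\<forall>\<^sub>F x in at z. (v x - Re (G x)) / (norm (x - z))\<^sup>2 < 0"
    using order_tendstoD(2)[OF G(4), of 0] L by simp
  with assms(2) have "\<forall>\<^sub>F x in at z. Re (G z) < Re (G x)"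
    by eventually_elim (auto simp: divide_less_0_iff G(3))
  then obtain d where d: "d > 0" "\<And>x. x \<noteq> z \<Longrightarrow> dist x z < d \<Longrightarrow> Re (G z) < Re (G x)"
    by (auto simp: eventually_at)
  define e where "e = min d r"
  have e: "e > 0" "e \<le> d" "e \<le> r" using d G(1) by (auto simp: e_def)
  have hol: "(\<lambda>x. exp (- G x)) holomorphic_on ball z e"
    by (intro holomorphic_intros holomorphic_on_subset[OF G(2)]) (use e in auto)
  have "(\<lambda>x. exp (- G x)) constant_on ball z e"
  proof (rule maximum_modulus_principle[OF hol _ _ open_ball _ _, of z])
    fix x assume "x \<in> ball z e"
    thus "norm (exp (- G x)) \<le> norm (exp (- G z))"
      using d(2)[of x] e by (cases "x = z") (auto simp: dist_commute)
  qed (use e in auto)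
  then obtain k where k: "\<And>x. x \<in> ball z e \<Longrightarrow> exp (- G x) = k"
    by (auto simp: constant_on_def)
  have "z + of_real (e / 2) \<in> ball z e" using e by (auto simp: dist_norm)
  hence "norm (exp (- G (z + of_real (e / 2)))) = norm (exp (- G z))"
    using k[of z] k[of "z + of_real (e/2)"] e by simp
  moreover have "Re (G z) < Re (G (z + of_real (e / 2)))"
    by (rule d(2)) (use e in \<open>auto simp: dist_norm\<close>)
  ultimately show False by simp
qed

lemma has_laplacian_rotate:
  assumes "has_laplacian v L (u * z)" "norm u = 1"
  shows "has_laplacian (\<lambda>x. v (u * x)) L z"
proof -
  from assms(1) obtain G r where G: "r > 0" "G holomorphic_on ball (u * z) r" "v (u * z) = Re (G (u * z))"
    "((\<lambda>x. (v x - Re (G x)) / (norm (x - u * z))\<^sup>2) \<longlongrightarrow> L / 4) (at (u * z))"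
    unfolding has_laplacian_def by blast
  have n: "norm (u * x - u * z) = norm (x - z)" for x
    using assms(2) by (simp flip: right_diff_distrib add: norm_mult)
  have "(G \<circ> (\<lambda>x. u * x)) holomorphic_on ball z r"
    by (rule holomorphic_on_compose_gen[OF _ G(2)])
       (auto intro!: holomorphic_intros simp: dist_norm n norm_minus_commute[of "u*z"] norm_minus_commute[of z])
  moreover have "filterlim (\<lambda>x. u * x) (at (u * z)) (at z)"
    unfolding filterlim_at using assms(2)
    by (auto intro!: tendsto_eq_intros simp: eventually_at_filter)
  from filterlim_compose[OF G(4) this]
  have "((\<lambda>x. (v (u * x) - Re (G (u * x))) / (norm (x - z))\<^sup>2) \<longlongrightarrow> L / 4) (at z)"
    by (simp add: n)
  ultimately show ?thesis
    using G(1,3) by (intro has_laplacianI[of r "G \<circ> (\<lambda>x. u * x)"]) auto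
qed

lemma has_laplacian_reflect:
  assumes "has_laplacian v L (of_real s - cnj z)"
  shows "has_laplacian (\<lambda>x. v (of_real s - cnj x)) L z"
proof -
  let ?y = "of_real s - cnj z"
  from assms(1) obtain G r where G: "r > 0" "G holomorphic_on ball ?y r" "v ?y = Re (G ?y)"
    "((\<lambda>x. (v x - Re (G x)) / (norm (x - ?y))\<^sup>2) \<longlongrightarrow> L / 4) (at ?y)"
    unfolding has_laplacian_def by blast
  have n: "norm ((of_real s - cnj x) - ?y) = norm (x - z)" for x
    by (metis (no_types, lifting) complex_cnj_diff complex_mod_cnj diff_diff_eq2 add_diff_cancel_left' diff_add_cancel norm_minus_commute add.commute)
  have "(G \<circ> (\<lambda>x. of_real s - x)) holomorphic_on ball (cnj z) r"
    by (rule holomorphic_on_compose_gen[OF _ G(2)])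
       (auto intro!: holomorphic_intros simp: dist_norm norm_minus_commute)
  moreover have "cnj ` ball z r = ball (cnj z) r"
  proof -
    have "x \<in> cnj ` ball z r \<longleftrightarrow> x \<in> ball (cnj z) r" for x
    proof -
      have "dist z (cnj x) = dist (cnj z) x"
        by (metis complex_cnj_cnj complex_cnj_diff complex_mod_cnj dist_norm)
      thus ?thesis by (force simp: image_iff intro!: bexI[of _ "cnj x"])
    qed
    thus ?thesis by blast
  qed
  \<comment> \<open>Reflection is antiholomorphic; conjugating the values of \<open>G\<close> restores holomorphy and keeps the real part.\<close>
  ultimately have "(cnj \<circ> (G \<circ> (\<lambda>x. of_real s - x)) \<circ> cnj) holomorphic_on ball z r"
    by (subst holomorphic_on_compose_cnj_cnj) auto
  moreover have "filterlim (\<lambda>x. of_real s - cnj x) (at ?y) (at z)"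
    unfolding filterlim_at
    by (auto intro!: tendsto_eq_intros simp: eventually_at_filter)
  from filterlim_compose[OF G(4) this]
  have "((\<lambda>x. (v (of_real s - cnj x) - Re (G (of_real s - cnj x))) / (norm (x - z))\<^sup>2) \<longlongrightarrow> L / 4) (at z)"
    by (simp only: n)
  ultimately show ?thesis
    using G(1,3) by (intro has_laplacianI[of r "cnj \<circ> (G \<circ> (\<lambda>x. of_real s - x)) \<circ> cnj"]) auto
qed

section \<open>Minimum principles\<close>

text \<open>
  A minimum principle for linear equations whose zeroth-order term has the bad sign: look at the
  point where \<open>v / \<phi>\<close> takes a negative minimum \<open>- m\<close>. There \<open>v + m * \<phi>\<close> has
  a local minimum, so its Laplacian cannot be negative. The equation for \<open>v\<close> enters only where
  \<open>v\<close> is negative.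
\<close>

lemma supersolution_comparison:
  assumes K: "compact K" "continuous_on K v" "continuous_on K \<phi>"
    and \<phi>_pos: "\<And>z. z \<in> K \<Longrightarrow> \<phi> z > 0"
    and S: "open S" "S \<subseteq> K" "\<And>z. z \<in> K - S \<Longrightarrow> v z \<ge> 0"
    and lap: "\<And>z. z \<in> S \<Longrightarrow> v z < 0 \<Longrightarrow>
        \<exists>L M. has_laplacian v L z \<and> has_laplacian \<phi> M z \<and> L - v z / \<phi> z * M < 0"
    and z: "z \<in> K"
  shows "v z \<ge> 0"
proof (rule ccontr)
  assume neg: "\<not> v z \<ge> 0"
  have "continuous_on K (\<lambda>x. v x / \<phi> x)"
    using \<phi>_pos by (intro continuous_intros K) (auto simp: less_imp_neq dest: less_imp_neq[symmetric])
  then obtain p where p: "p \<in> K" "\<And>x. x \<in> K \<Longrightarrow> v p / \<phi> p \<le> v x / \<phi> x"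
    using continuous_attains_inf[OF K(1)] z by blast
  define m where "m = - v p / \<phi> p"
  have "v z / \<phi> z < 0"
    using neg \<phi>_pos[OF z] by (simp add: divide_neg_pos)
  hence "v p / \<phi> p < 0" using p(2)[OF z] by linarith
  hence vp: "v p < 0" using \<phi>_pos[OF p(1)] by (simp add: divide_less_0_iff)
  hence "p \<in> S" using S(3)[of p] p(1) by force
  then obtain L M where L: "has_laplacian v L p" "has_laplacian \<phi> M p" "L - v p / \<phi> p * M < 0"
    using lap vp by blast
  have "has_laplacian (\<lambda>x. v x + m * \<phi> x) (L + m * M) p"
    by (intro has_laplacian_add has_laplacian_cmult L)
  moreover have "\<forall>\<^sub>F x in at p. v p + m * \<phi> p \<le> v x + m * \<phi> x"
  proof -
    have "\<forall>\<^sub>F x in at p. x \<in> S"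
      using eventually_at_in_open'[OF S(1) \<open>p \<in> S\<close>] .
    thus ?thesis
    proof eventually_elim
      case (elim x)
      hence x: "x \<in> K" using S by auto
      have "- m \<le> v x / \<phi> x" using p(2)[OF x] by (simp add: m_def)
      hence "- m * \<phi> x \<le> v x" using \<phi>_pos[OF x] by (simp add: pos_le_divide_eq)
      moreover have "v p + m * \<phi> p = 0" using \<phi>_pos[OF p(1)] by (simp add: m_def)
      ultimately show ?case by linarith
    qed
  qed
  ultimately have "L + m * M \<ge> 0" by (rule has_laplacian_min_nonneg)
  thus False using L(3) by (simp add: m_def)
qed

text \<open>
  Here \<open>2 - |z|\<^sup>2\<close> is a strict supersolution, positive on the closed disc.
\<close>

lemma weak_minimum_principle:
  assumes K: "compact K" "continuous_on K v" "K \<subseteq> cball 0 1"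
    and S: "open S" "S \<subseteq> K" "\<And>z. z \<in> K - S \<Longrightarrow> v z \<ge> 0"
    and lap: "\<And>z. z \<in> S \<Longrightarrow> \<exists>L\<le>0. has_laplacian v L z"
    and z: "z \<in> K"
  shows "v z \<ge> 0"
proof (rule supersolution_comparison[OF K(1,2) _ _ S _ z])
  show "continuous_on K (\<lambda>z. 2 - (norm z)\<^sup>2)" by (intro continuous_intros)
  show pos: "2 - (norm z)\<^sup>2 > 0" if "z \<in> K" for z :: complex
  proof -
    have "norm z \<le> 1" using that K(3) by auto
    hence "(norm z)\<^sup>2 \<le> 1" by (simp add: power_le_one)
    thus ?thesis by simp
  qed
  fix z assume z: "z \<in> S" "v z < 0"
  obtain L where L: "L \<le> 0" "has_laplacian v L z" using lap z by blast
  have "has_laplacian (\<lambda>z. Re 2 - (norm z)\<^sup>2) (0 - 4) z"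
    by (intro has_laplacian_diff has_laplacian_norm_sq has_laplacian_Re) auto
  moreover define q where "q = v z / (2 - (norm z)\<^sup>2)"
  have "q < 0" unfolding q_def using z(2) pos[of z] z(1) S(2) by (auto intro!: divide_neg_pos)
  hence "L - q * (0 - 4) < 0" using L(1) by simp
  ultimately show "\<exists>L M. has_laplacian v L z \<and> has_laplacian (\<lambda>z. 2 - (norm z)\<^sup>2) M z \<and>
      L - v z / (2 - (norm z)\<^sup>2) * M < 0"
    unfolding q_def using L(2) by (intro exI[of _ L] exI[of _ "0 - 4"]) simp
qed

section \<open>The Liouville equation with constant boundary values\<close>

definition liouville_solution :: "(complex \<Rightarrow> real) \<Rightarrow> real \<Rightarrow> bool" where
  "liouville_solution U b \<longleftrightarrow> continuous_on (cball 0 1) U \<and> (\<forall>z. norm z = 1 \<longrightarrow> U z = b) \<and>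
     (\<forall>z\<in>ball 0 1. has_laplacian U (4 * exp (- 2 * U z)) z)"

text \<open>
  A point of equality would be an interior maximum of a function with positive Laplacian.
\<close>

lemma liouville_solution_less_boundary:
  assumes "liouville_solution U b" "norm z < 1"
  shows "U z < b"
proof -
  have cont: "continuous_on (cball 0 1) U" and bd: "\<And>z. norm z = 1 \<Longrightarrow> U z = b"
    and lap: "\<And>z. norm z < 1 \<Longrightarrow> has_laplacian U (4 * exp (- 2 * U z)) z"
    using assms(1) by (auto simp: liouville_solution_def)
  have lap': "has_laplacian (\<lambda>z. b - U z) (- 4 * exp (- 2 * U z)) z" if "norm z < 1" for z
    using has_laplacian_diff[OF has_laplacian_Re[of "\<lambda>_. of_real b"] lap[OF that]] by simp
  have le: "b - U z \<ge> 0" if "norm z \<le> 1" for z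
  proof (rule weak_minimum_principle[of "cball 0 1" "\<lambda>z. b - U z" "ball 0 1"])
    show "\<exists>L\<le>0. has_laplacian (\<lambda>z. b - U z) L z" if "z \<in> ball 0 1" for z
      using lap'[of z] that by (intro exI[of _ "- 4 * exp (- 2 * U z)"]) auto
  qed (use that bd cont in \<open>auto intro!: continuous_intros\<close>)
  have "b - U z \<noteq> 0"
  proof
    assume 0: "b - U z = 0"
    have "\<forall>\<^sub>F x in at z. x \<in> ball 0 1"
      using assms(2) by (intro eventually_at_in_open') auto
    hence "\<forall>\<^sub>F x in at z. b - U z \<le> b - U x"
      by eventually_elim (use 0 le in \<open>auto simp del: diff_ge_0_iff_ge\<close>)
    from has_laplacian_min_nonneg[OF lap'[OF assms(2)] this] show False by simp
  qed
  with le[of z] assms(2) show ?thesis by simp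
qed

text \<open>
  The right-hand side of the Liouville equation is Lipschitz in \<open>U\<close>, so the difference of two
  solutions satisfies a linear differential inequality with a bounded coefficient.
\<close>

lemma exp_diff_le:
  fixes a b :: real
  assumes "8 * exp (- 2 * a) \<le> M" "a \<le> b"
  shows "4 * exp (- 2 * a) - 4 * exp (- 2 * b) \<le> M * (b - a)"
proof -
  have "1 + (- 2 * (b - a)) \<le> exp (- 2 * (b - a))" by (rule exp_ge_add_one_self)
  hence "4 * exp (- 2 * a) * (1 - exp (- 2 * (b - a))) \<le> 4 * exp (- 2 * a) * (2 * (b - a))"
    by (intro mult_left_mono) (linarith, simp)
  also have "\<dots> = 8 * exp (- 2 * a) * (b - a)" by simp
  also have "\<dots> \<le> M * (b - a)" using assms by (intro mult_right_mono) auto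
  also have "4 * exp (- 2 * a) * (1 - exp (- 2 * (b - a))) = 4 * exp (- 2 * a) - 4 * exp (- 2 * b)"
    by (simp add: right_diff_distrib flip: exp_add)
  finally show ?thesis .
qed

section \<open>Moving planes\<close>

definition mirror :: "real \<Rightarrow> complex \<Rightarrow> complex" where
  "mirror t z = of_real (2 * t) - cnj z"

lemma norm_mirror_sq: "(norm (mirror t z))\<^sup>2 = (norm z)\<^sup>2 - 4 * t * (Re z - t)"
  unfolding mirror_def cmod_power2 by (simp add: power2_eq_square algebra_simps)

lemma norm_mirror_le: "0 \<le> t \<Longrightarrow> t \<le> Re z \<Longrightarrow> norm (mirror t z) \<le> norm z"
  by (rule power2_le_imp_le) (auto simp: norm_mirror_sq)

lemma norm_mirror_less: "0 < t \<Longrightarrow> t < Re z \<Longrightarrow> norm (mirror t z) < norm z"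
  by (rule power2_less_imp_less) (auto simp: norm_mirror_sq)

lemma mirror_fixed: "Re z = t \<Longrightarrow> mirror t z = z"
  by (auto simp: mirror_def complex_eq_iff)

lemma continuous_mirror [continuous_intros]: "continuous_on A (mirror t)"
  unfolding mirror_def by (intro continuous_intros)

context
  fixes U :: "complex \<Rightarrow> real" and b :: real
  assumes sol: "liouville_solution U b"
begin

lemma U_cont: "continuous_on (cball 0 1) U" and U_bd: "norm z = 1 \<Longrightarrow> U z = b"
    and U_lap: "norm z < 1 \<Longrightarrow> has_laplacian U (4 * exp (- 2 * U z)) z"
  using sol by (auto simp: liouville_solution_def)

lemma reflection_gap_cont:
  assumes "0 \<le> t" "A \<subseteq> {z. norm z \<le> 1 \<and> t \<le> Re z}"
  shows "continuous_on A (\<lambda>z. U z - U (mirror t z))"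
proof (intro continuous_intros)
  show "continuous_on A U" using U_cont by (rule continuous_on_subset) (use assms in auto)
  have "\<And>z. norm z \<le> 1 \<Longrightarrow> t \<le> Re z \<Longrightarrow> norm (mirror t z) \<le> 1"
    using norm_mirror_le[OF assms(1)] order_trans by blast
  thus "continuous_on A (\<lambda>z. U (mirror t z))"
    by (intro continuous_on_compose2[OF U_cont] continuous_intros) (use assms(2) in auto)
qed

lemma reflection_gap_laplacian:
  assumes "0 \<le> t" "t \<le> Re z" "norm z < 1"
  shows "has_laplacian (\<lambda>z. U z - U (mirror t z)) (4 * exp (- 2 * U z) - 4 * exp (- 2 * U (mirror t z))) z"
proof -
  have "norm (mirror t z) < 1" using norm_mirror_le[OF assms(1,2)] assms(3) by linarith
  from has_laplacian_diff[OF U_lap[OF assms(3)] has_laplacian_reflect[OF U_lap[OF this, unfolded mirror_def]]]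
  show ?thesis by (simp add: mirror_def)
qed

lemma reflection_gap_boundary:
  assumes "0 < t" "t < Re z" "norm z = 1"
  shows "U z - U (mirror t z) > 0"
  using norm_mirror_less[OF assms(1,2)] assms(3) U_bd[of z] liouville_solution_less_boundary[OF sol, of "mirror t z"]
  by simp

lemma reflection_gap_boundary_le:
  assumes "0 < t" "t \<le> Re z" "norm z = 1"
  shows "U z - U (mirror t z) \<ge> 0"
  using reflection_gap_boundary[of t z] mirror_fixed[of z t] assms by (cases "t = Re z") auto

text \<open>
  On a strip of width less than \<open>B\<close> the function \<open>B\<^sup>2 - (Re z - t)\<^sup>2\<close> is positive with Laplacian
  \<open>- 2\<close>. For small \<open>B\<close> this outweighs the coefficient \<open>M\<close> of the linear inequality,
  so the minimum principle holds although \<open>M\<close> has the bad sign.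
\<close>

lemma narrow_strip:
  assumes M: "\<And>z. norm z \<le> 1 \<Longrightarrow> 8 * exp (- 2 * U z) \<le> M" and B: "B > 0" "B\<^sup>2 * M < 2"
    and t: "0 < t" "s < t + B"
    and right: "\<And>z. norm z \<le> 1 \<Longrightarrow> Re z = s \<Longrightarrow> U (mirror t z) \<le> U z"
    and z: "norm z \<le> 1" "t \<le> Re z" "Re z \<le> s"
  shows "U (mirror t z) \<le> U z"
proof -
  define K where "K = {z. norm z \<le> 1 \<and> t \<le> Re z \<and> Re z \<le> s}"
  define S where "S = {z. norm z < 1 \<and> t < Re z \<and> Re z < s}"
  have KS: "K = cball 0 1 \<inter> {z. Re z \<ge> t} \<inter> {z. Re z \<le> s}"
    "S = ball 0 1 \<inter> {z. Re z > t} \<inter> {z. Re z < s}" by (auto simp: K_def S_def)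
  have pos: "B\<^sup>2 - (Re z - t)\<^sup>2 > 0" if "z \<in> K" for z
  proof -
    have "(Re z - t)\<^sup>2 < B\<^sup>2" using that t by (intro power_strict_mono) (auto simp: K_def)
    thus ?thesis by simp
  qed
  have "U z - U (mirror t z) \<ge> 0"
  proof (rule supersolution_comparison[where v = "\<lambda>z. U z - U (mirror t z)" and \<phi> = "\<lambda>z. B\<^sup>2 - (Re z - t)\<^sup>2"
        and K = K and S = S])
    show "compact K" unfolding KS
      by (intro compact_Int_closed compact_cball closed_halfspace_Re_ge closed_halfspace_Re_le)
    show "open S" unfolding KS
      by (intro open_Int open_ball open_halfspace_Re_gt open_halfspace_Re_lt)
    show "continuous_on K (\<lambda>z. U z - U (mirror t z))"
      by (rule reflection_gap_cont) (use t in \<open>auto simp: K_def\<close>)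
    show "continuous_on K (\<lambda>z. B\<^sup>2 - (Re z - t)\<^sup>2)" by (intro continuous_intros)
    show "S \<subseteq> K" by (auto simp: K_def S_def)
    show "0 < B\<^sup>2 - (Re z - t)\<^sup>2" if "z \<in> K" for z by (rule pos[OF that])
    show "z \<in> K" using z by (auto simp: K_def)
  next
    fix z assume "z \<in> K - S"
    then consider "norm z = 1" "t \<le> Re z" | "t = Re z" | "Re z = s" "norm z \<le> 1"
      by (force simp: K_def S_def)
    thus "U z - U (mirror t z) \<ge> 0"
      by cases (use reflection_gap_boundary_le[OF t(1)] mirror_fixed[of z t] right[of z] in auto)
  next
    fix z assume z: "z \<in> S" "U z - U (mirror t z) < 0"
    define \<phi> where "\<phi> = B\<^sup>2 - (Re z - t)\<^sup>2"
    define w where "w = U (mirror t z) - U z"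
    have \<phi>: "\<phi> > 0" "\<phi> \<le> B\<^sup>2" using pos[of z] z by (auto simp: \<phi>_def S_def K_def)
    have w: "w > 0" using z by (simp add: w_def)
    let ?L = "4 * exp (- 2 * U z) - 4 * exp (- 2 * U (mirror t z))"
    have L: "?L \<le> M * w" unfolding w_def
      by (rule exp_diff_le[OF M]) (use z in \<open>auto simp: S_def\<close>)
    have "0 < 8 * exp (- 2 * U z)" by simp
    also have "\<dots> \<le> M" by (rule M) (use z in \<open>auto simp: S_def\<close>)
    finally have "M > 0" .
    hence "M * \<phi> \<le> B\<^sup>2 * M" using \<phi> by (simp add: mult.commute)
    also have "\<dots> < 2" by (rule B)
    finally have "M < 2 / \<phi>" using \<phi> by (simp add: pos_less_divide_eq)
    hence "M * w < 2 / \<phi> * w" using w by (intro mult_strict_right_mono)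
    with L have "?L < w / \<phi> * 2" by (simp add: mult.commute)
    moreover have "(U z - U (mirror t z)) / \<phi> = - (w / \<phi>)" by (simp add: w_def diff_divide_distrib)
    ultimately have "?L - (U z - U (mirror t z)) / \<phi> * (0 - 2) < 0" by (simp only:) simp
    moreover have "has_laplacian (\<lambda>z. U z - U (mirror t z)) ?L z"
      by (rule reflection_gap_laplacian) (use z t in \<open>auto simp: S_def\<close>)
    moreover have "has_laplacian (\<lambda>z. Re (of_real (B\<^sup>2)) - (Re z - t)\<^sup>2) (0 - 2) z"
      by (intro has_laplacian_diff has_laplacian_Re_sq has_laplacian_Re) auto
    ultimately show "\<exists>L M. has_laplacian (\<lambda>z. U z - U (mirror t z)) L z \<and>
        has_laplacian (\<lambda>z. B\<^sup>2 - (Re z - t)\<^sup>2) M z \<and>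
        L - (U z - U (mirror t z)) / (B\<^sup>2 - (Re z - t)\<^sup>2) * M < 0"
      unfolding \<phi>_def by (intro exI[of _ ?L] exI[of _ "0 - 2"]) auto
  qed
  thus ?thesis by simp
qed

definition dominated :: "real \<Rightarrow> bool" where
  "dominated t \<longleftrightarrow> (\<forall>z. norm z \<le> 1 \<longrightarrow> t \<le> Re z \<longrightarrow> U (mirror t z) \<le> U z)"

text \<open>
  Where the reflection gap is nonnegative it is also superharmonic. It is bounded below by some
  \<open>d > 0\<close> on the part of the circle with \<open>Re z \<ge> t + e\<close>, so on the boundary of the cap it
  is at least the harmonic function \<open>d * (Re z - t - e)\<close>, which is at most \<open>d\<close> everywhere
  and at most \<open>0\<close> on the rest of that boundary. The weak minimum principle carries this positive lower bound inside;
  it takes the place of the strong maximum principle and of the Hopf lemma.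
\<close>

lemma dominated_strict:
  assumes t: "0 < t" "dominated t" and z1: "norm z1 \<le> 1" "t < Re z1"
  shows "U (mirror t z1) < U z1"
proof -
  define e where "e = (Re z1 - t) / 2"
  have e: "e > 0" "t + e < Re z1" using z1 by (auto simp: e_def field_simps)
  have Re1: "Re z1 \<le> 1" using z1 complex_Re_le_cmod[of z1] by linarith
  define A where "A = sphere 0 1 \<inter> {z. Re z \<ge> t + e}"
  have "compact A" unfolding A_def by (intro compact_Int_closed compact_sphere closed_halfspace_Re_ge)
  moreover have "1 \<in> A" using e Re1 by (auto simp: A_def)
  moreover have "continuous_on A (\<lambda>z. U z - U (mirror t z))"
    by (rule reflection_gap_cont) (use t e in \<open>auto simp: A_def\<close>)
  ultimately obtain p where p: "p \<in> A" "\<And>z. z \<in> A \<Longrightarrow> U p - U (mirror t p) \<le> U z - U (mirror t z)"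
    using continuous_attains_inf[of A "\<lambda>z. U z - U (mirror t z)"] by blast
  define d where "d = U p - U (mirror t p)"
  have d: "d > 0" unfolding d_def
    by (rule reflection_gap_boundary) (use p t e in \<open>auto simp: A_def\<close>)
  define v where "v = (\<lambda>z. U z - U (mirror t z) - Re (of_real d * (z - of_real (t + e))))"
  define K where "K = cball 0 1 \<inter> {z. Re z \<ge> t}"
  define S where "S = ball 0 1 \<inter> {z. Re z > t}"
  have "v z1 \<ge> 0"
  proof (rule weak_minimum_principle[of K v S])
    show "compact K" unfolding K_def by (intro compact_Int_closed compact_cball closed_halfspace_Re_ge)
    show "open S" unfolding S_def by (intro open_Int open_ball open_halfspace_Re_gt)
    show "continuous_on K v" unfolding v_def
      by (intro continuous_on_diff[OF reflection_gap_cont] continuous_intros) (use t in \<open>auto simp: K_def\<close>)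
    show "K \<subseteq> cball 0 1" "S \<subseteq> K" "z1 \<in> K" using z1 by (auto simp: K_def S_def)
  next
    fix z assume z: "z \<in> K - S"
    have Rez: "Re z \<le> 1" using z complex_Re_le_cmod[of z] by (auto simp: K_def)
    have "U z - U (mirror t z) \<ge> d * (Re z - (t + e))"
    proof (cases "z \<in> A")
      case True
      have "d * (Re z - (t + e)) \<le> d * 1" using d t e Rez by (intro mult_left_mono) auto
      also have "\<dots> \<le> U z - U (mirror t z)" using p(2)[OF True] by (simp add: d_def)
      finally show ?thesis .
    next
      case False
      hence "Re z \<le> t + e" using z e by (auto simp: A_def K_def S_def)
      hence "d * (Re z - (t + e)) \<le> 0" using d by (simp add: mult_le_0_iff)
      moreover have "U z - U (mirror t z) \<ge> 0" using t(2) z by (auto simp: dominated_def K_def)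
      ultimately show ?thesis by linarith
    qed
    thus "v z \<ge> 0" by (simp add: v_def)
  next
    fix z assume z: "z \<in> S"
    let ?L = "4 * exp (- 2 * U z) - 4 * exp (- 2 * U (mirror t z))"
    have "has_laplacian v (?L - 0) z" unfolding v_def
      by (intro has_laplacian_diff[OF reflection_gap_laplacian] has_laplacian_Re holomorphic_intros)
         (use z t in \<open>auto simp: S_def\<close>)
    moreover have "?L \<le> 0" using t(2) z by (auto simp: dominated_def S_def)
    ultimately show "\<exists>L\<le>0. has_laplacian v L z" by (intro exI[of _ "?L - 0"]) simp
  qed
  moreover have "d * (Re z1 - (t + e)) > 0" using d e by simp
  ultimately show ?thesis by (simp add: v_def)
qed

lemma tendsto_reflection:
  assumes "0 \<le> t" "t < Re z" "norm z \<le> 1"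
  shows "((\<lambda>s. U (mirror s z)) \<longlongrightarrow> U (mirror t z)) (at_right t)"
proof (rule continuous_on_tendsto_compose[OF U_cont])
  show "((\<lambda>s. mirror s z) \<longlongrightarrow> mirror t z) (at_right t)"
    unfolding mirror_def by (intro tendsto_intros)
  show "mirror t z \<in> cball 0 1" using norm_mirror_le[of t z] assms by simp
  have "\<forall>\<^sub>F s in at_right t. s < Re z" "\<forall>\<^sub>F s in at_right t. t < s"
    using assms(2) by (auto intro: eventually_at_right_less order_tendstoD)
  thus "\<forall>\<^sub>F s in at_right t. mirror s z \<in> cball 0 1"
  proof eventually_elim
    case (elim s)
    thus ?case using norm_mirror_le[of s z] assms by simp
  qed
qed

lemma dominated_closed:
  assumes "0 \<le> t" "\<And>s. t < s \<Longrightarrow> s \<le> 1 \<Longrightarrow> dominated s"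
  shows "dominated t"
  unfolding dominated_def
proof (intro allI impI)
  fix z :: complex assume z: "norm z \<le> 1" "t \<le> Re z"
  show "U (mirror t z) \<le> U z"
  proof (cases "t = Re z")
    case False
    with z have "t < Re z" by simp
    have "\<forall>\<^sub>F s in at_right t. U (mirror s z) \<le> U z"
    proof -
      have "\<forall>\<^sub>F s in at_right t. s < Re z" "\<forall>\<^sub>F s in at_right t. t < s"
        using \<open>t < Re z\<close> by (auto intro: eventually_at_right_less order_tendstoD)
      thus ?thesis
      proof eventually_elim
        case (elim s)
        moreover have "Re z \<le> 1" using z complex_Re_le_cmod[of z] by linarith
        ultimately show ?case using assms(2)[of s] z by (auto simp: dominated_def)
      qed
    qed
    with tendsto_reflection[OF assms(1) \<open>t < Re z\<close> z(1)] show ?thesis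
      by (rule tendsto_upperbound) auto
  qed (simp add: mirror_fixed)
qed

text \<open>
  Split the cap for \<open>s < t\<close> at \<open>Re z = t + B / 2\<close>. To the right, the gap for \<open>t\<close> has a positive
  minimum by compactness, and uniform continuity keeps the gap for \<open>s\<close> positive. What is left is a
  strip narrower than \<open>B\<close>.
\<close>

lemma dominated_open:
  assumes t: "0 < t" "dominated t"
  shows "\<exists>r. 0 \<le> r \<and> r < t \<and> (\<forall>s. r < s \<longrightarrow> s \<le> t \<longrightarrow> dominated s)"
proof -
  obtain M where M: "\<And>z. norm z \<le> 1 \<Longrightarrow> 8 * exp (- 2 * U z) \<le> M"
  proof -
    have "continuous_on (cball 0 1) (\<lambda>z. 8 * exp (- 2 * U z))" by (intro continuous_intros U_cont)
    from continuous_attains_sup[OF compact_cball _ this]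
    obtain p where "\<And>z. z \<in> cball 0 1 \<Longrightarrow> 8 * exp (- 2 * U z) \<le> 8 * exp (- 2 * U p)"
      using cball_eq_empty[of 0 "1::real"] by (metis not_one_less_zero)
    thus ?thesis by (intro that[of "8 * exp (- 2 * U p)"]) simp
  qed
  define B where "B = 1 / (1 + \<bar>M\<bar>)"
  have B: "B > 0" by (simp add: B_def)
  have "B\<^sup>2 * M \<le> 1"
  proof -
    have "B\<^sup>2 * M \<le> B\<^sup>2 * (1 + \<bar>M\<bar>)" by (intro mult_left_mono) auto
    also have "\<dots> = B" by (simp add: B_def power2_eq_square)
    also have "\<dots> \<le> 1" by (simp add: B_def)
    finally show ?thesis .
  qed
  hence BM: "B\<^sup>2 * M < 2" by simp
  define A where "A = cball 0 1 \<inter> {z. Re z \<ge> t + B / 2}"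
  have compA: "compact A" unfolding A_def by (intro compact_Int_closed compact_cball closed_halfspace_Re_ge)
  have contA: "continuous_on A (\<lambda>z. U z - U (mirror t z))"
    by (rule reflection_gap_cont) (use t B in \<open>auto simp: A_def\<close>)
  obtain d where d: "d > 0" "\<And>z. z \<in> A \<Longrightarrow> d \<le> U z - U (mirror t z)"
  proof (cases "A = {}")
    case False
    from continuous_attains_inf[OF compA False contA]
    obtain p where p: "p \<in> A" "\<And>z. z \<in> A \<Longrightarrow> U p - U (mirror t p) \<le> U z - U (mirror t z)" by blast
    have "U p - U (mirror t p) > 0"
      using dominated_strict[OF t, of p] p(1) B by (auto simp: A_def)
    thus ?thesis using that p(2) by blast
  qed (use that[of 1] in auto)
  have "uniformly_continuous_on (cball 0 1) U"
    by (intro compact_uniformly_continuous U_cont compact_cball)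
  from uniformly_continuous_onE[OF this d(1)] obtain \<eta> where \<eta>: "\<eta> > 0"
    "\<And>x y. x \<in> cball 0 1 \<Longrightarrow> y \<in> cball 0 1 \<Longrightarrow> dist y x < \<eta> \<Longrightarrow> dist (U y) (U x) < d"
    by blast
  have close: "\<bar>U y - U x\<bar> < d" if "norm x \<le> 1" "norm y \<le> 1" "norm (y - x) < \<eta>" for x y
    using \<eta>(2)[of x y] that by (simp add: dist_norm)
  define r where "r = Max {0, t - B / 2, t - \<eta> / 2}"
  have r: "0 \<le> r" "t - B / 2 \<le> r" "t - \<eta> / 2 \<le> r" "r < t"
    using t B \<eta> by (auto simp: r_def)
  have "dominated s" if s: "r < s" "s \<le> t" for s
  proof -
    have onA: "U (mirror s z) \<le> U z" if z: "z \<in> A" for z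
    proof -
      have "mirror s z - mirror t z = of_real (2 * (s - t))"
        by (simp add: mirror_def)
      hence "norm (mirror s z - mirror t z) = 2 * (t - s)"
        using s by (simp only: norm_of_real) simp
      also have "\<dots> < \<eta>" using r s by simp
      finally have "\<bar>U (mirror s z) - U (mirror t z)\<bar> < d"
      proof (intro close)
        show "norm (mirror s z) \<le> 1" "norm (mirror t z) \<le> 1"
          using norm_mirror_le[of s z] norm_mirror_le[of t z] z s r B by (auto simp: A_def)
      qed
      with d(2)[OF z] show ?thesis by linarith
    qed
    show ?thesis unfolding dominated_def
    proof (intro allI impI)
      fix z :: complex assume z: "norm z \<le> 1" "s \<le> Re z"
      show "U (mirror s z) \<le> U z"
      proof (cases "z \<in> A")
        case False
        show ?thesis
          by (rule narrow_strip[OF M B BM, of s "t + B / 2"])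
             (use z False s r onA B in \<open>auto simp: A_def\<close>)
      qed (rule onA)
    qed
  qed
  with r show ?thesis by blast
qed

text \<open>
  The set of \<open>t\<close> down to which the reflection inequality holds contains \<open>1\<close>, where the cap
  is the single point \<open>1\<close> on the mirror line; its infimum belongs to it and cannot be positive.
\<close>

lemma dominated_zero: "dominated 0"
proof -
  define S where "S = {t. 0 \<le> t \<and> t \<le> 1 \<and> (\<forall>s. t \<le> s \<longrightarrow> s \<le> 1 \<longrightarrow> dominated s)}"
  have "dominated 1" unfolding dominated_def
  proof (intro allI impI)
    fix z :: complex assume "norm z \<le> 1" "1 \<le> Re z"
    hence "Re z = 1" using complex_Re_le_cmod[of z] by linarith
    thus "U (mirror 1 z) \<le> U z" by (simp add: mirror_fixed)
  qed
  hence "dominated s" if "1 \<le> s" "s \<le> 1" for s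
    using order_antisym[OF that(2,1)] by simp
  hence 1: "1 \<in> S" by (simp add: S_def)
  have bdd: "bdd_below S" by (rule bdd_belowI[of _ 0]) (auto simp: S_def)
  define t where "t = Inf S"
  have "0 \<le> t" unfolding t_def
  proof (rule cInf_greatest)
    show "S \<noteq> {}" using 1 by blast
  qed (simp add: S_def)
  moreover have "t \<le> 1" unfolding t_def by (rule cInf_lower[OF 1 bdd])
  ultimately have t: "0 \<le> t" "t \<le> 1" .
  have above: "dominated s" if "t < s" "s \<le> 1" for s
  proof -
    have "\<exists>r\<in>S. r < s"
      using that(1) cInf_less_iff[OF _ bdd, of s] 1 unfolding t_def by blast
    then obtain r where "r \<in> S" "r < s" by blast
    thus ?thesis using that by (simp add: S_def)
  qed
  have dt: "dominated t" by (rule dominated_closed[OF t(1) above])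
  have "t = 0"
  proof (rule ccontr)
    assume "t \<noteq> 0"
    with t have "0 < t" by simp
    from dominated_open[OF this dt] obtain r
      where r: "0 \<le> r" "r < t" "\<And>s. r < s \<Longrightarrow> s \<le> t \<Longrightarrow> dominated s" by blast
    have "(r + t) / 2 \<in> S"
    proof -
      have "dominated s" if "(r + t) / 2 \<le> s" "s \<le> 1" for s
        using r(2) r(3)[of s] above[of s] that by (cases "s \<le> t") auto
      thus ?thesis using r(1,2) t by (simp add: S_def)
    qed
    hence "t \<le> (r + t) / 2" unfolding t_def by (intro cInf_lower bdd)
    with r show False by simp
  qed
  with dt show ?thesis by simp
qed

lemma reflection_le: "norm z \<le> 1 \<Longrightarrow> 0 \<le> Re z \<Longrightarrow> U (- cnj z) \<le> U z"
  using dominated_zero by (auto simp: dominated_def mirror_def)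

end

lemma liouville_solution_rotate:
  assumes "liouville_solution U b" "norm u = 1"
  shows "liouville_solution (\<lambda>z. U (u * z)) b"
  unfolding liouville_solution_def
proof (intro conjI ballI allI impI)
  show "continuous_on (cball 0 1) (\<lambda>z. U (u * z))"
    by (intro continuous_on_compose2[OF U_cont[OF assms(1)]] continuous_intros) (auto simp: norm_mult assms(2))
  show "U (u * z) = b" if "norm z = 1" for z
    using that assms by (intro U_bd[OF assms(1)]) (auto simp: norm_mult)
  show "has_laplacian (\<lambda>z. U (u * z)) (4 * exp (- 2 * U (u * z))) z" if "z \<in> ball 0 1" for z
    using that assms by (intro has_laplacian_rotate U_lap[OF assms(1)]) (auto simp: norm_mult)
qed

text \<open>
  Two points on the same circle around \<open>0\<close> are exchanged by the reflection in a suitable line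
  through \<open>0\<close>. The reflection inequality for both directions normal to this line gives equality.
\<close>

theorem liouville_solution_radial:
  assumes U: "liouville_solution U b" and p: "norm p \<le> 1" "norm q = norm p"
  shows "U q = U p"
proof (cases "p = 0")
  case False
  \<comment> \<open>The map \<open>x \<mapsto> - (u\<^sup>2) * cnj x\<close> is the reflection that sends \<open>p\<close> to \<open>q\<close>.
    Of the two roots \<open>u\<close>, take the one that puts \<open>cnj u * p\<close> in the right half-plane.\<close>
  define r where "r = csqrt (- q / cnj p)"
  have r2: "r\<^sup>2 = - q / cnj p" by (simp add: r_def)
  have "(norm r)\<^sup>2 = 1" using p False by (simp add: r2 norm_divide flip: norm_power)
  hence nr: "norm r = 1" by (simp add: power2_eq_1_iff) (metis norm_ge_zero not_one_le_zero neg_0_le_iff_le)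
  define u where "u = (if Re (cnj r * p) \<ge> 0 then r else - r)"
  have u: "norm u = 1" "u\<^sup>2 = - q / cnj p" "Re (cnj u * p) \<ge> 0"
    using nr r2 by (auto simp: u_def)
  define z where "z = cnj u * p"
  have uu: "u * cnj u = 1" using u(1) complex_norm_square[of u] by simp
  have uz: "u * z = p" using uu by (simp add: z_def flip: mult.assoc)
  have "u * (- cnj z) = - (u\<^sup>2) * cnj p" by (simp add: z_def power2_eq_square)
  also have "\<dots> = q" using False by (simp add: u(2))
  finally have q: "u * (- cnj z) = q" .
  have z: "norm z \<le> 1" "Re z \<ge> 0" using u p by (auto simp: z_def norm_mult)
  have "U q \<le> U p"
    using reflection_le[OF liouville_solution_rotate[OF U u(1)] z] uz q by simp
  moreover have "U p \<le> U q"
    using reflection_le[OF liouville_solution_rotate[OF U, of "- u"], of "cnj z"] u(1) z uz q by simp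
  ultimately show ?thesis by simp
qed (use p in auto)

section \<open>The spherical derivative near a point\<close>

text \<open>
  In a chart with \<open>g z = 0\<close> the equation can be read off: \<open>ln |g'|\<close> is the real part of a holomorphic
  logarithm, and \<open>ln (1 + |g|\<^sup>2)\<close> is \<open>|g' z|\<^sup>2 * |x - z|\<^sup>2\<close> up to a smaller error.
\<close>

lemma has_laplacian_log_metric:
  assumes r: "r > 0" and g: "g holomorphic_on ball z r" "g z = 0"
    and g': "\<And>x. x \<in> ball z r \<Longrightarrow> deriv g x \<noteq> 0"
    and U: "\<And>x. x \<in> ball z r \<Longrightarrow> U x = - ln (norm (deriv g x) / (1 + (norm (g x))\<^sup>2))"
  shows "has_laplacian U (4 * exp (- 2 * U z)) z"
proof -
  have hol': "deriv g holomorphic_on ball z r" by (intro holomorphic_deriv g open_ball)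
  obtain l where l: "l holomorphic_on ball z r" "\<And>x. x \<in> ball z r \<Longrightarrow> deriv g x = exp (l x)"
    using contractible_imp_holomorphic_log[OF hol' _ g']
    by (metis convex_ball convex_imp_contractible)
  have U': "U x = ln (1 + (norm (g x))\<^sup>2) - Re (l x)" if "x \<in> ball z r" for x
  proof -
    have "1 + (norm (g x))\<^sup>2 > 0" by (simp add: add_pos_nonneg)
    thus ?thesis using U[OF that] l(2)[OF that] by (simp add: ln_div)
  qed
  have der: "(g has_field_derivative deriv g z) (at z)"
    using g(1) r by (intro holomorphic_derivI[OF _ open_ball]) auto
  have lim: "((\<lambda>x. norm (g x) / norm (x - z)) \<longlongrightarrow> norm (deriv g z)) (at z)"
    using tendsto_norm[OF der[unfolded has_field_derivative_iff]] g(2) by (simp add: norm_divide)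
  have g0: "((\<lambda>x. (norm (g x))\<^sup>2) \<longlongrightarrow> 0) (at z)"
    using DERIV_isCont[OF der] g(2) by (auto simp: isCont_def intro!: tendsto_eq_intros)
  \<comment> \<open>The quotient is given its limit at \<open>0\<close>, since \<open>g\<close> need not avoid \<open>0\<close> a priori.\<close>
  have ln1: "((\<lambda>y::real. if y = 0 then 1 else ln (1 + y) / y) \<longlongrightarrow> 1) (nhds 0)"
  proof -
    have "((\<lambda>y::real. ln (1 + y)) has_real_derivative 1) (at 0)"
      by (auto intro!: derivative_eq_intros)
    hence "((\<lambda>y::real. ln (1 + y) / y) \<longlongrightarrow> 1) (at 0)"
      by (simp add: has_field_derivative_iff)
    hence "((\<lambda>y::real. if y = 0 then 1 else ln (1 + y) / y) \<longlongrightarrow> 1) (at 0)"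
      by (rule Lim_transform_eventually) (auto simp: eventually_at_filter)
    thus ?thesis by (simp add: tendsto_nhds_iff)
  qed
  let ?h = "\<lambda>y::real. if y = 0 then 1 else ln (1 + y) / y"
  have "((\<lambda>x. ?h ((norm (g x))\<^sup>2) * (norm (g x) / norm (x - z))\<^sup>2) \<longlongrightarrow> 1 * (norm (deriv g z))\<^sup>2) (at z)"
    by (intro tendsto_mult tendsto_power lim filterlim_compose[OF ln1 g0])
  moreover have "\<forall>\<^sub>F x in at z. ?h ((norm (g x))\<^sup>2) * (norm (g x) / norm (x - z))\<^sup>2 =
      (U x - Re (- l x)) / (norm (x - z))\<^sup>2"
  proof -
    have "\<forall>\<^sub>F x in at z. x \<in> ball z r" using r by (intro eventually_at_in_open') auto
    thus ?thesis
    proof eventually_elim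
      case (elim x)
      show ?case unfolding U'[OF elim] by (simp add: power_divide)
    qed
  qed
  ultimately have "((\<lambda>x. (U x - Re (- l x)) / (norm (x - z))\<^sup>2) \<longlongrightarrow> 1 * (norm (deriv g z))\<^sup>2) (at z)"
    by (rule Lim_transform_eventually)
  moreover have "(norm (deriv g z))\<^sup>2 = exp (- 2 * U z)"
    using U'[of z] l(2)[of z] r g(2) by (simp flip: exp_double)
  ultimately show ?thesis
    using r l(1) U'[of z] g(2) by (intro has_laplacianI[of r "\<lambda>x. - l x"]) (auto intro!: holomorphic_intros)
qed

text \<open>
  The spherical derivative does not change when a rotation of the sphere is applied to \<open>f\<close>. Choose a
  rotation that moves the value of \<open>f\<close> at \<open>z\<close> to \<open>0\<close>: the inversion at a pole, and otherwise
  \<open>w \<mapsto> (w - f z) / (1 + cnj (f z) * w)\<close>. Local univalence then makes the derivative of the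
  resulting holomorphic function nonzero.
\<close>

lemma spherical_derivative_chart:
  assumes "f nicely_meromorphic_on A" "locally_univalent_on f A" "open A" "z \<in> A"
  shows "\<exists>g r. r > 0 \<and> ball z r \<subseteq> A \<and> g holomorphic_on ball z r \<and> g z = 0 \<and>
      (\<forall>x\<in>ball z r. deriv g x \<noteq> 0 \<and>
         spherical_derivative f x = norm (deriv g x) / (1 + (norm (g x))\<^sup>2))"
proof -
  obtain V where V: "open V" "z \<in> V" "V \<subseteq> A" "inj_on (sphere_map f) V"
    using assms(2,4) by (auto simp: locally_univalent_on_def)
  have mero: "f meromorphic_on A" using assms(1) by (simp add: nicely_meromorphic_on_def)
  show ?thesis
  proof (cases "is_pole f z")
    case False
    define a where "a = f z"
    have "f analytic_on {z}"
      using nicely_meromorphic_on_imp_analytic_at[OF assms(1,4) False] .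
    then obtain e where e: "e > 0" "f holomorphic_on ball z e" by (auto simp: analytic_on_def)
    have cont: "isCont f z"
      using e by (meson centre_in_ball continuous_on_eq_continuous_at holomorphic_on_imp_continuous_on open_ball)
    have "1 + cnj a * a \<noteq> 0"
    proof -
      have "1 + cnj a * a = of_real (1 + (norm a)\<^sup>2)" using complex_norm_square[of a] by (simp add: mult.commute)
      moreover have "1 + (norm a)\<^sup>2 \<noteq> 0" by (metis add_pos_nonneg less_numeral_extra(1,3) zero_le_power2)
      ultimately show ?thesis by (metis of_real_eq_0_iff)
    qed
    hence nz: "1 + (norm a)\<^sup>2 > 0" "1 + cnj a * a \<noteq> 0" by (auto simp: add_pos_nonneg)
    have "((\<lambda>x. 1 + cnj a * f x) \<longlongrightarrow> 1 + cnj a * a) (nhds z)"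
      using cont by (auto simp: isCont_def a_def tendsto_nhds_iff intro!: tendsto_intros)
    from tendsto_imp_eventually_ne[OF this nz(2)]
    obtain d where d: "d > 0" "\<And>x. dist x z < d \<Longrightarrow> 1 + cnj a * f x \<noteq> 0"
      by (auto simp: eventually_nhds_metric)
    obtain k where k: "k > 0" "ball z k \<subseteq> V" using V(1,2) by (auto elim: openE)
    define r where "r = Min {d, e, k}"
    have r: "r > 0" "r \<le> d" "r \<le> e" "r \<le> k" using d e k by (auto simp: r_def)
    have hf: "f holomorphic_on ball z r" using e(2) by (rule holomorphic_on_subset) (use r in auto)
    have ne: "1 + cnj a * f x \<noteq> 0" if "x \<in> ball z r" for x
      using d(2)[of x] that r by (auto simp: dist_commute)
    have np: "\<not> is_pole f x" if "x \<in> ball z r" for x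
      using hf that not_is_pole_holomorphic open_ball by blast
    have inj: "inj_on f (ball z r)"
    proof (rule inj_onI)
      fix x y assume xy: "x \<in> ball z r" "y \<in> ball z r" "f x = f y"
      hence "sphere_map f x = sphere_map f y" using np by (simp add: sphere_map_def)
      thus "x = y" using inj_onD[OF V(4)] xy k r by (meson ball_subset_cball less_le_trans mem_ball subsetD)
    qed
    have f': "deriv f x \<noteq> 0" if "x \<in> ball z r" for x
      by (rule holomorphic_injective_imp_regular[OF hf open_ball inj that])
    define g where "g = (\<lambda>x. (f x - a) / (1 + cnj a * f x))"
    have hg: "g holomorphic_on ball z r" unfolding g_def
      by (intro holomorphic_intros hf) (use ne in auto)
    have dg: "deriv g x = deriv f x * of_real (1 + (norm a)\<^sup>2) / (1 + cnj a * f x)\<^sup>2" if x: "x \<in> ball z r" for x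
    proof (rule DERIV_imp_deriv)
      have "(f has_field_derivative deriv f x) (at x)"
        using hf x by (intro holomorphic_derivI[OF _ open_ball]) auto
      thus "(g has_field_derivative deriv f x * of_real (1 + (norm a)\<^sup>2) / (1 + cnj a * f x)\<^sup>2) (at x)"
        unfolding g_def using ne[OF x] complex_norm_square[of a]
        by (auto intro!: derivative_eq_intros simp: power2_eq_square algebra_simps)
    qed
    have sd: "spherical_derivative f x = norm (deriv g x) / (1 + (norm (g x))\<^sup>2)" if x: "x \<in> ball z r" for x
    proof -
      define N where "N = norm (1 + cnj a * f x)"
      have N: "N > 0" using ne[OF x] by (simp add: N_def)
      \<comment> \<open>The identity that makes this map a rotation of the sphere.\<close>
      have id: "N\<^sup>2 + (norm (f x - a))\<^sup>2 = (1 + (norm a)\<^sup>2) * (1 + (norm (f x))\<^sup>2)"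
        unfolding N_def cmod_power2 by (simp add: power2_eq_square algebra_simps)
      have "1 + (norm (g x))\<^sup>2 = (N\<^sup>2 + (norm (f x - a))\<^sup>2) / N\<^sup>2"
        using N by (simp add: g_def norm_divide power_divide add_divide_distrib flip: N_def)
      moreover have "norm (deriv g x) = norm (deriv f x) * (1 + (norm a)\<^sup>2) / N\<^sup>2"
        unfolding dg[OF x] norm_divide norm_mult norm_power norm_of_real N_def using nz by simp
      ultimately have "norm (deriv g x) / (1 + (norm (g x))\<^sup>2) =
          norm (deriv f x) * (1 + (norm a)\<^sup>2) / ((1 + (norm a)\<^sup>2) * (1 + (norm (f x))\<^sup>2))"
        using N id by simp
      also have "\<dots> = norm (deriv f x) / (1 + (norm (f x))\<^sup>2)" using nz(1) by simp
      finally show ?thesis using np[OF x] by (simp add: spherical_derivative_def)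
    qed
    have "deriv g x \<noteq> 0" if "x \<in> ball z r" for x
    proof -
      have "complex_of_real (1 + (norm a)\<^sup>2) \<noteq> 0" using nz(1) by (metis less_numeral_extra(3) of_real_eq_0_iff)
      thus ?thesis unfolding dg[OF that] using f'[OF that] ne[OF that] by simp
    qed
    moreover have "ball z r \<subseteq> A" using k V r by (meson order_trans subset_ball)
    ultimately show ?thesis using r(1) hg sd by (intro exI[of _ g] exI[of _ r]) (auto simp: g_def a_def)
  next
    case True
    have "isolated_singularity_at f z" using mero assms(4) meromorphic_on_isolated_singularity
      by (meson meromorphic_on_subset empty_subsetI insert_subset)
    then obtain e where e: "e > 0" "f analytic_on ball z e - {z}" by (auto simp: isolated_singularity_at_def)
    obtain d where d: "d > 0" "\<And>x. x \<noteq> z \<Longrightarrow> dist x z < d \<Longrightarrow> f x \<noteq> 0"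
      using non_zero_neighbour_pole[OF True] by (auto simp: eventually_at)
    obtain k where k: "k > 0" "ball z k \<subseteq> V" using V(1,2) by (auto elim: openE)
    define r where "r = Min {d, e, k}"
    have r: "r > 0" "r \<le> d" "r \<le> e" "r \<le> k" using d e k by (auto simp: r_def)
    have hf: "f holomorphic_on ball z r - {z}"
      using analytic_imp_holomorphic[OF e(2)] by (rule holomorphic_on_subset) (use r in auto)
    have ne: "f x \<noteq> 0" if "x \<in> ball z r - {z}" for x
      using d(2)[of x] that r by (auto simp: dist_commute)
    define g where "g = (\<lambda>x. if x = z then 0 else inverse (f x))"
    have hg: "g holomorphic_on ball z r" unfolding g_def
      by (rule is_pole_inverse_holomorphic[OF open_ball hf True]) (use ne in auto)
    have np: "\<not> is_pole f x" if "x \<in> ball z r - {z}" for x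
      using hf that not_is_pole_holomorphic[of "ball z r - {z}"] by blast
    have inj: "inj_on g (ball z r)"
    proof (rule inj_onI)
      fix x y assume xy: "x \<in> ball z r" "y \<in> ball z r" "g x = g y"
      hence "sphere_map f x = sphere_map f y" using np[of x] np[of y] ne[of x] ne[of y] True
        by (auto simp: sphere_map_def g_def split: if_splits)
      thus "x = y" using inj_onD[OF V(4)] xy k r by (meson ball_subset_cball less_le_trans mem_ball subsetD)
    qed
    have g': "deriv g x \<noteq> 0" if "x \<in> ball z r" for x
      by (rule holomorphic_injective_imp_regular[OF hg open_ball inj that])
    have sd1: "norm (deriv f x) / (1 + (norm (f x))\<^sup>2) = norm (deriv g x) / (1 + (norm (g x))\<^sup>2)"
      if x: "x \<in> ball z r - {z}" for x
    proof -
      have "(f has_field_derivative deriv f x) (at x)"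
        using hf x by (intro holomorphic_derivI[of _ "ball z r - {z}"]) auto
      hence "((\<lambda>x. inverse (f x)) has_field_derivative - deriv f x / (f x)\<^sup>2) (at x)"
        using ne[OF x] by (auto intro!: derivative_eq_intros simp: power2_eq_square field_simps)
      hence "(g has_field_derivative - deriv f x / (f x)\<^sup>2) (at x)"
        by (rule has_field_derivative_transform_within_open[of _ _ _ "ball z r - {z}"]) (use x in \<open>auto simp: g_def\<close>)
      hence dg: "norm (deriv g x) = norm (deriv f x) / (norm (f x))\<^sup>2"
        by (simp add: DERIV_imp_deriv norm_divide norm_power)
      have "norm (f x) > 0" using ne[OF x] by simp
      moreover from this have "1 + (norm (f x))\<^sup>2 > 0" by (simp add: add_pos_pos)
      moreover have "1 + (norm (g x))\<^sup>2 = (1 + (norm (f x))\<^sup>2) / (norm (f x))\<^sup>2"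
        using x \<open>norm (f x) > 0\<close> by (simp add: g_def norm_inverse power_inverse add_divide_distrib inverse_eq_divide[of "_ ^ 2"] norm_divide)
      ultimately show ?thesis unfolding dg by simp
    qed
    have sdz: "spherical_derivative f z = norm (deriv g z) / (1 + (norm (g z))\<^sup>2)"
    proof -
      have "isCont (\<lambda>x. norm (deriv g x) / (1 + (norm (g x))\<^sup>2)) z"
      proof -
        have "continuous_on (ball z r) (\<lambda>x. norm (deriv g x) / (1 + (norm (g x))\<^sup>2))"
          by (intro continuous_intros holomorphic_on_imp_continuous_on hg holomorphic_deriv open_ball)
             (metis add_pos_nonneg less_numeral_extra(1,3) zero_le_power2)
        thus ?thesis using r(1) by (simp add: continuous_on_eq_continuous_at)
      qed
      hence "((\<lambda>x. norm (deriv g x) / (1 + (norm (g x))\<^sup>2)) \<longlongrightarrow> norm (deriv g z) / (1 + (norm (g z))\<^sup>2)) (at z)"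
        by (simp add: isCont_def)
      moreover have "\<forall>\<^sub>F x in at z. norm (deriv g x) / (1 + (norm (g x))\<^sup>2) = norm (deriv f x) / (1 + (norm (f x))\<^sup>2)"
        using eventually_at_in_open[OF open_ball, of z z r] r(1)
        by (auto elim!: eventually_mono simp: sd1)
      ultimately have "((\<lambda>x. norm (deriv f x) / (1 + (norm (f x))\<^sup>2)) \<longlongrightarrow> norm (deriv g z) / (1 + (norm (g z))\<^sup>2)) (at z)"
        by (rule Lim_transform_eventually)
      thus ?thesis using True by (simp add: spherical_derivative_def tendsto_Lim)
    qed
    have "spherical_derivative f x = norm (deriv g x) / (1 + (norm (g x))\<^sup>2)" if "x \<in> ball z r" for x
      using sdz sd1[of x] np[of x] that by (cases "x = z") (auto simp: spherical_derivative_def)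
    moreover have "ball z r \<subseteq> A" using k V r by (meson order_trans subset_ball)
    ultimately show ?thesis using r(1) hg g' by (intro exI[of _ g] exI[of _ r]) (auto simp: g_def)
  qed
qed

section \<open>Metrics invariant under rotation\<close>

text \<open>
  A function of two complex variables that is holomorphic on complex lines and vanishes on
  \<open>w = cnj z\<close> vanishes identically. In the coordinates \<open>z = s + \<i> t\<close>, \<open>w = s - \<i> t\<close> the hypothesis
  concerns real \<open>s\<close> and \<open>t\<close>, and the identity theorem makes first \<open>s\<close> and then \<open>t\<close> complex.
  The point \<open>(z, 0)\<close> has \<open>s = z / 2\<close> and \<open>t = z / (2 \<i>)\<close>.
\<close>

lemma polarization_holomorphic:
  fixes \<Phi> :: "complex \<Rightarrow> complex \<Rightarrow> complex"
  assumes e: "e > 0"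
    and hol: "\<And>p q a b. (\<lambda>s. \<Phi> (p * s + a) (q * s + b)) holomorphic_on
        {s. norm (p * s + a) < e \<and> norm (q * s + b) < e}"
    and diag: "\<And>z. norm z < e \<Longrightarrow> \<Phi> z (cnj z) = 0"
    and z: "norm z < e"
  shows "\<Phi> z 0 = 0"
proof -
  define d where "d = e / 2"
  have d: "d > 0" using e by (simp add: d_def)
  have real_imp_all: "h s = 0" if h: "h holomorphic_on ball 0 d" and r: "\<And>t. \<bar>t\<bar> < d \<Longrightarrow> h (of_real t) = 0"
    and s: "norm s < d" for h :: "complex \<Rightarrow> complex" and s
  proof (rule analytic_continuation[OF h open_ball connected_ball, of "of_real ` {-d<..<d}" 0 s])
    show "0 islimpt complex_of_real ` {-d<..<d}"
    proof -
      have "(0::real) islimpt {-d<..<d}"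
        using d by (intro open_imp_islimpt) auto
      hence "complex_of_real 0 islimpt complex_of_real ` {-d<..<d}"
        by (rule islimpt_isCont_image) (auto intro!: continuous_intros simp: eventually_at_filter)
      thus ?thesis by simp
    qed
  qed (use s r d in auto)
  have nrm: "norm (x + y) < e" "norm (x - y) < e" if "norm x < d" "norm y < d" for x y :: complex
    using that norm_triangle_ineq[of x y] norm_triangle_ineq4[of x y] by (auto simp: d_def)
  have step1: "\<Phi> (s + \<i> * of_real t) (s - \<i> * of_real t) = 0" if t: "\<bar>t\<bar> < d" and s: "norm s < d" for s t
  proof (rule real_imp_all[OF _ _ s])
    have "(\<lambda>s. \<Phi> (1 * s + \<i> * of_real t) (1 * s + (- \<i> * of_real t))) holomorphic_on ball 0 d"
    proof (rule holomorphic_on_subset[OF hol])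
      have "norm (\<i> * of_real t) < d" using t by (simp add: norm_mult)
      thus "ball 0 d \<subseteq> {s. cmod (1 * s + \<i> * of_real t) < e \<and> cmod (1 * s + - \<i> * of_real t) < e}"
        using nrm by auto
    qed
    thus "(\<lambda>s. \<Phi> (s + \<i> * of_real t) (s - \<i> * of_real t)) holomorphic_on ball 0 d" by simp
    fix x :: real assume x: "\<bar>x\<bar> < d"
    have "norm (of_real x + \<i> * of_real t) < e"
      by (rule nrm) (use x t in \<open>auto simp: norm_mult\<close>)
    from diag[OF this] show "\<Phi> (of_real x + \<i> * of_real t) (of_real x - \<i> * of_real t) = 0" by simp
  qed
  have step2: "\<Phi> (s + \<i> * t) (s - \<i> * t) = 0" if s: "norm s < d" and t: "norm t < d" for s t
  proof (rule real_imp_all[OF _ _ t])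
    have "(\<lambda>t. \<Phi> (\<i> * t + s) (- \<i> * t + s)) holomorphic_on ball 0 d"
    proof (rule holomorphic_on_subset[OF hol], safe)
      fix t :: complex assume "t \<in> ball 0 d"
      hence "norm (\<i> * t) < d" by (simp add: norm_mult)
      from nrm[OF s this] show "norm (\<i> * t + s) < e" "norm (- \<i> * t + s) < e"
        by (simp_all add: add.commute)
    qed
    thus "(\<lambda>t. \<Phi> (s + \<i> * t) (s - \<i> * t)) holomorphic_on ball 0 d" by (simp add: add.commute)
    show "\<Phi> (s + \<i> * of_real t) (s - \<i> * of_real t) = 0" if "\<bar>t\<bar> < d" for t
      by (rule step1[OF that s])
  qed
  have "\<Phi> (z / 2 + \<i> * (z / (2 * \<i>))) (z / 2 - \<i> * (z / (2 * \<i>))) = 0"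
    by (rule step2) (use z in \<open>auto simp: d_def norm_divide norm_mult\<close>)
  thus ?thesis by simp
qed

lemma holomorphic_on_cnj_cnj:
  assumes "f holomorphic_on ball 0 e"
  shows "(\<lambda>w. cnj (f (cnj w))) holomorphic_on ball 0 e"
proof -
  have "cnj ` ball 0 e = ball 0 e" by (auto simp: image_iff intro!: bexI[of _ "cnj _"])
  hence "(cnj \<circ> f \<circ> cnj) holomorphic_on ball 0 e"
    using assms by (subst holomorphic_on_compose_cnj_cnj) auto
  thus ?thesis by (simp add: o_def)
qed

text \<open>
  Polarise the squared reciprocal of the metric; squaring replaces \<open>|1 / f'|\<close> by the product of
  \<open>1 / f'\<close> and its conjugate. At second variable \<open>0\<close> every factor that contains \<open>f\<close>
  becomes trivial because of \<open>f 0 = 0\<close>, and only \<open>1 / f'\<close> remains.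
\<close>

lemma rotation_invariant_metric_imp_deriv_eq:
  assumes e: "e > 0" and f: "f holomorphic_on ball 0 e" "f 0 = 0"
    and f': "\<And>z. norm z < e \<Longrightarrow> deriv f z \<noteq> 0"
    and u: "norm u = 1"
    and inv: "\<And>z. norm z < e \<Longrightarrow> norm (deriv f (u * z)) / (1 + (norm (f (u * z)))\<^sup>2) =
        norm (deriv f z) / (1 + (norm (f z))\<^sup>2)"
    and z: "norm z < e"
  shows "deriv f (u * z) = deriv f z"
proof -
  define k where "k = (\<lambda>z. inverse (deriv f z))"
  have hk: "k holomorphic_on ball 0 e" unfolding k_def
    by (intro holomorphic_intros holomorphic_deriv f(1) open_ball) (use f' in auto)
  define P where "P = (\<lambda>F K z w. K z * cnj (K (cnj w)) * (1 + F z * cnj (F (cnj w)))\<^sup>2 :: complex)"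
  define \<Phi> where "\<Phi> = (\<lambda>z w. P (\<lambda>z. f (u * z)) (\<lambda>z. k (u * z)) z w - P f k z w)"
  have rot: "(\<lambda>z. g (u * z)) holomorphic_on ball 0 e" if "g holomorphic_on ball 0 e" for g
  proof -
    have "(g \<circ> (\<lambda>z. u * z)) holomorphic_on ball 0 e"
      by (rule holomorphic_on_compose_gen[OF _ that]) (use u in \<open>auto simp: norm_mult intro!: holomorphic_intros\<close>)
    thus ?thesis by (simp add: o_def)
  qed
  have comp: "(\<lambda>s. g (p * s + a)) holomorphic_on T"
    if "g holomorphic_on ball 0 e" "\<And>s. s \<in> T \<Longrightarrow> norm (p * s + a) < e"
    for g :: "complex \<Rightarrow> complex" and p a T
  proof -
    have "(g \<circ> (\<lambda>s. p * s + a)) holomorphic_on T"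
      by (rule holomorphic_on_compose_gen[OF _ that(1)]) (use that(2) in \<open>auto intro!: holomorphic_intros\<close>)
    thus ?thesis by (simp add: o_def)
  qed
  have holP: "(\<lambda>s. P F K (p * s + a) (q * s + b)) holomorphic_on
      {s. norm (p * s + a) < e \<and> norm (q * s + b) < e}"
    if "F holomorphic_on ball 0 e" "K holomorphic_on ball 0 e" for F K p q a b
    unfolding P_def
    by (intro holomorphic_intros comp[OF that(1)] comp[OF that(2)]
        comp[OF holomorphic_on_cnj_cnj[OF that(1)]] comp[OF holomorphic_on_cnj_cnj[OF that(2)]]) auto
  have Pdiag: "P F K z (cnj z) = of_real ((norm (K z) * (1 + (norm (F z))\<^sup>2))\<^sup>2)" for F K z
    unfolding P_def complex_cnj_cnj complex_norm_square[symmetric] by (simp add: power_mult_distrib)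
  have "\<Phi> z 0 = 0"
  proof (rule polarization_holomorphic[OF e _ _ z])
    show "(\<lambda>s. \<Phi> (p * s + a) (q * s + b)) holomorphic_on
        {s. norm (p * s + a) < e \<and> norm (q * s + b) < e}" for p q a b
      unfolding \<Phi>_def by (intro holomorphic_intros holP rot f(1) hk)
    fix z :: complex assume z: "norm z < e"
    have "norm (k (u * z)) * (1 + (norm (f (u * z)))\<^sup>2) = inverse (norm (deriv f (u * z)) / (1 + (norm (f (u * z)))\<^sup>2))"
      by (simp add: k_def norm_inverse divide_inverse)
    also have "\<dots> = norm (k z) * (1 + (norm (f z))\<^sup>2)"
      unfolding inv[OF z] by (simp add: k_def norm_inverse divide_inverse)
    finally show "\<Phi> z (cnj z) = 0" unfolding \<Phi>_def Pdiag by simp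
  qed
  hence "k (u * z) * cnj (k 0) = k z * cnj (k 0)"
    by (simp add: \<Phi>_def P_def f(2))
  moreover have "k 0 \<noteq> 0" using f'[of 0] e by (simp add: k_def)
  ultimately show ?thesis by (simp add: k_def)
qed

text \<open>
  The derivative is constant on one circle, hence everywhere.
\<close>

lemma rotation_invariant_metric_imp_linear:
  assumes e: "e > 0" and f: "f holomorphic_on ball 0 e" "f 0 = 0"
    and f': "\<And>z. norm z < e \<Longrightarrow> deriv f z \<noteq> 0"
    and inv: "\<And>u z. norm u = 1 \<Longrightarrow> norm z < e \<Longrightarrow>
        norm (deriv f (u * z)) / (1 + (norm (f (u * z)))\<^sup>2) = norm (deriv f z) / (1 + (norm (f z))\<^sup>2)"
    and z: "norm z < e"
  shows "f z = deriv f 0 * z"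
proof -
  define p where "p = complex_of_real (e / 2)"
  have p: "norm p < e" "norm p > 0" using e by (auto simp: p_def)
  have hol': "deriv f holomorphic_on ball 0 e" by (intro holomorphic_deriv f open_ball)
  have on_sphere: "deriv f x - deriv f p = 0" if "x \<in> sphere 0 (norm p)" for x
  proof -
    have u: "norm (x / p) = 1" using that p by (simp add: norm_divide)
    have "deriv f (x / p * p) = deriv f p"
      by (rule rotation_invariant_metric_imp_deriv_eq[OF e f f' u inv[OF u] p(1)])
    moreover have "x / p * p = x" using p by auto
    ultimately show ?thesis by simp
  qed
  have const: "deriv f x - deriv f p = 0" if "norm x < e" for x
  proof (rule analytic_continuation[where S = "ball 0 e" and U = "sphere 0 (norm p)" and \<xi> = p
        and f = "\<lambda>x. deriv f x - deriv f p" and w = x])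
    show "(\<lambda>x. deriv f x - deriv f p) holomorphic_on ball 0 e" by (intro holomorphic_intros hol')
    show "p islimpt sphere 0 (norm p)"
    proof (rule connected_imp_perfect[OF connected_sphere])
      show "sphere 0 (norm p) \<noteq> {a}" for a :: complex
      proof
        assume a: "sphere 0 (norm p) = {a}"
        have "p \<in> sphere 0 (norm p)" "- p \<in> sphere 0 (norm p)" by simp_all
        hence "p = - p" unfolding a by (metis singletonD)
        thus False using p(2) by simp
      qed
    qed simp_all
    show "sphere 0 (norm p) \<subseteq> ball 0 e" "p \<in> ball 0 e" "x \<in> ball 0 e"
      using p(1) that by auto
    show "deriv f x - deriv f p = 0" if "x \<in> sphere 0 (norm p)" for x
      by (rule on_sphere[OF that])
  qed simp_all
  have "(\<lambda>x. f x - deriv f 0 * x) constant_on ball 0 e"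
  proof (rule has_field_derivative_0_imp_constant_on)
    fix x :: complex assume x: "x \<in> ball 0 e"
    have "(f has_field_derivative deriv f x) (at x)"
      using f(1) x by (intro holomorphic_derivI[OF _ open_ball]) auto
    moreover have "deriv f x = deriv f 0" using const[of x] const[of 0] x e by auto
    ultimately show "((\<lambda>x. f x - deriv f 0 * x) has_field_derivative 0) (at x)"
      by (auto intro!: derivative_eq_intros)
  qed auto
  then obtain c where "\<And>x. norm x < e \<Longrightarrow> f x - deriv f 0 * x = c"
    by (auto simp: constant_on_def)
  from this[of 0] this[of z] show ?thesis using e z f(2) by simp
qed

section \<open>Constant boundary values of the spherical derivative\<close>

text \<open>
  The identity theorem gives the equation off a sparse set. The finite limit of \<open>f\<close> at each point
  then excludes poles, and continuity off the poles fixes the value.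
\<close>

lemma nicely_meromorphic_eq_linear:
  assumes f: "f nicely_meromorphic_on A" and A: "open A" "connected A" "w \<in> A"
    and ev: "\<forall>\<^sub>F x in at w. f x = \<eta> * x" and z: "z \<in> A"
  shows "\<not> is_pole f z \<and> f z = \<eta> * z"
proof -
  have "(\<lambda>x. f x - \<eta> * x) meromorphic_on A"
    using f by (auto simp: nicely_meromorphic_on_def intro!: meromorphic_intros)
  from meromorphic_imp_constant_or_avoid[OF this A(1,2), of 0]
  have "\<forall>\<^sub>\<approx>x\<in>A. f x = \<eta> * x"
  proof
    assume "\<forall>\<^sub>\<approx>x\<in>A. f x - \<eta> * x \<noteq> 0"
    hence "\<forall>\<^sub>F x in at w. f x - \<eta> * x \<noteq> 0" using A by (simp add: eventually_cosparse_open_eq)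
    with ev have "\<forall>\<^sub>F x in at w. False" by eventually_elim auto
    thus ?thesis by simp
  qed simp
  hence "\<forall>\<^sub>F x in at z. f x = \<eta> * x" using A z by (simp add: eventually_cosparse_open_eq)
  hence lim: "(f \<longlongrightarrow> \<eta> * z) (at z)"
    by (rule Lim_transform_eventually[rotated, OF eventually_mono]) (auto intro!: tendsto_intros)
  hence np: "\<not> is_pole f z"
    using is_pole_def not_tendsto_and_filterlim_at_infinity[of "at z" f] by auto
  with f z have "f \<midarrow>z\<rightarrow> f z" by (auto simp: nicely_meromorphic_on_def)
  with lim np show ?thesis using tendsto_unique[of "at z"] by auto
qed

text \<open>
  The equation and continuity inside come from the local charts; continuity at the circle is the
  hypothesis on the boundary limits of the spherical derivative.
\<close>

lemma liouville_solution_spherical: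
  assumes "c > 0"
    and f: "f nicely_meromorphic_on ball 0 1" "locally_univalent_on f (ball 0 1)"
    and lim: "\<And>\<xi>. norm \<xi> = 1 \<Longrightarrow> (spherical_derivative f \<longlongrightarrow> c) (at \<xi> within ball 0 1)"
  shows "liouville_solution
    (\<lambda>z. if norm z < 1 then - ln (spherical_derivative f z) else - ln c) (- ln c)"
    (is "liouville_solution ?U _")
proof -
  have interior: "has_laplacian ?U (4 * exp (- 2 * ?U z)) z \<and> isCont ?U z" if z: "z \<in> ball 0 1" for z
  proof -
    obtain g r where g: "r > 0" "ball z r \<subseteq> ball 0 1" "g holomorphic_on ball z r" "g z = 0"
      "\<And>x. x \<in> ball z r \<Longrightarrow> deriv g x \<noteq> 0"
      "\<And>x. x \<in> ball z r \<Longrightarrow> spherical_derivative f x = norm (deriv g x) / (1 + (norm (g x))\<^sup>2)"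
      using spherical_derivative_chart[OF f open_ball z] by blast
    have U: "?U x = - ln (norm (deriv g x) / (1 + (norm (g x))\<^sup>2))" if "x \<in> ball z r" for x
      using g(6)[OF that] subsetD[OF g(2) that] by simp
    have pos: "1 + (norm (x::complex))\<^sup>2 > 0" for x by (simp add: add_pos_nonneg)
    have "continuous_on (ball z r) (\<lambda>x. - ln (norm (deriv g x) / (1 + (norm (g x))\<^sup>2)))"
      by (intro continuous_intros holomorphic_on_imp_continuous_on holomorphic_deriv g open_ball)
         (use g(5) pos in \<open>auto simp: less_imp_neq[symmetric] order_less_imp_not_eq2\<close>)
    hence "continuous_on (ball z r) ?U" by (rule continuous_on_eq) (use U in auto)
    hence "isCont ?U z" using g(1) by (simp add: continuous_on_eq_continuous_at)
    moreover have "has_laplacian ?U (4 * exp (- 2 * ?U z)) z"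
      by (rule has_laplacian_log_metric[OF g(1,3,4,5) U])
    ultimately show ?thesis by blast
  qed
  have "continuous_on (cball 0 1) ?U" unfolding continuous_on_def
  proof
    fix z :: complex assume z: "z \<in> cball 0 1"
    show "(?U \<longlongrightarrow> ?U z) (at z within cball 0 1)"
    proof (cases "norm z < 1")
      case True
      hence "isCont ?U z" using interior[of z] by simp
      hence "(?U \<longlongrightarrow> ?U z) (at z)" unfolding isCont_def .
      thus ?thesis by (rule tendsto_within_subset) (rule subset_UNIV)
    next
      case False
      hence z: "norm z = 1" using z by simp
      have "((\<lambda>x. - ln (spherical_derivative f x)) \<longlongrightarrow> - ln c) (at z within ball 0 1)"
        using lim[OF z] assms(1) by (intro tendsto_intros) auto
      hence "(?U \<longlongrightarrow> - ln c) (at z within ball 0 1)"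
        by (rule Lim_transform_eventually) (auto simp: eventually_at_filter)
      moreover have "(?U \<longlongrightarrow> - ln c) (at z within sphere 0 1)"
        by (rule Lim_transform_eventually[OF tendsto_const]) (auto simp: eventually_at_filter)
      ultimately have "(?U \<longlongrightarrow> - ln c) (at z within (ball 0 1 \<union> sphere 0 1))"
        unfolding at_within_union by (rule filterlim_sup)
      moreover have "ball 0 1 \<union> sphere 0 1 = cball (0::complex) 1" by auto
      ultimately show ?thesis using False by simp
    qed
  qed
  with interior show ?thesis unfolding liouville_solution_def by auto
qed

theorem theorem1p4:
  fixes c :: real and f :: "complex \<Rightarrow> complex"
  assumes "c > 0"
    and "f nicely_meromorphic_on ball 0 1"
    and "locally_univalent_on f (ball 0 1)"
    and "sphere_map f 0 = Some 0"
    and "\<And>\<xi>. norm \<xi> = 1 \<Longrightarrow>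
           (spherical_derivative f \<longlongrightarrow> c) (at \<xi> within ball 0 1)"
  shows "\<exists>\<eta>. \<forall>z\<in>ball 0 1. sphere_map f z = Some (\<eta> * z)"
proof -
  have f0: "\<not> is_pole f 0" "f 0 = 0" using assms(4) by (auto simp: sphere_map_def split: if_splits)
  note sol = liouville_solution_spherical[OF assms(1,2,3,5)]
  have spos: "spherical_derivative f x > 0" if x: "norm x < 1" for x
  proof -
    obtain g r where g: "r > 0" "\<And>y. y \<in> ball x r \<Longrightarrow> deriv g y \<noteq> 0 \<and>
        spherical_derivative f y = norm (deriv g y) / (1 + (norm (g y))\<^sup>2)"
      using spherical_derivative_chart[OF assms(2,3) open_ball, of x] x by (force simp del: mem_ball)
    moreover have "x \<in> ball x r" using g(1) by simp
    ultimately show ?thesis by (metis add_pos_nonneg divide_pos_pos zero_le_power2 zero_less_norm_iff zero_less_one)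
  qed
  have rad: "spherical_derivative f (u * z) = spherical_derivative f z" if "norm u = 1" "norm z < 1" for u z
  proof -
    have "norm (u * z) = norm z" using that by (simp add: norm_mult)
    hence "- ln (spherical_derivative f (u * z)) = - ln (spherical_derivative f z)"
      using liouville_solution_radial[OF sol, of z "u * z"] that by simp
    thus ?thesis using spos[of z] spos[of "u * z"] that \<open>norm (u * z) = norm z\<close> by simp
  qed
  have "f analytic_on {0}"
    by (rule nicely_meromorphic_on_imp_analytic_at[OF assms(2) _ f0(1)]) auto
  then obtain d where d: "d > 0" "f holomorphic_on ball 0 d" by (auto simp: analytic_on_def)
  define e where "e = min d 1"
  have e: "e > 0" "e \<le> 1" "f holomorphic_on ball 0 e"
    using d by (auto simp: e_def intro: holomorphic_on_subset)
  have np: "spherical_derivative f z = norm (deriv f z) / (1 + (norm (f z))\<^sup>2)" if "norm z < e" for z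
    using not_is_pole_holomorphic[OF open_ball _ e(3), of z] that by (simp add: spherical_derivative_def)
  have lin: "f z = deriv f 0 * z" if z: "norm z < e" for z
  proof (rule rotation_invariant_metric_imp_linear[OF e(1,3) f0(2) _ _ z])
    show "deriv f z \<noteq> 0" if "norm z < e" for z using np[OF that] spos[of z] that e by auto
    show "norm (deriv f (u * z)) / (1 + (norm (f (u * z)))\<^sup>2) = norm (deriv f z) / (1 + (norm (f z))\<^sup>2)"
      if "norm u = 1" "norm z < e" for u z
      using rad[of u z] np[of z] np[of "u * z"] that e by (simp add: norm_mult)
  qed
  have "\<forall>\<^sub>F x in at 0. x \<in> ball 0 e" using e by (intro eventually_at_in_open') auto
  hence "\<forall>\<^sub>F x in at 0. f x = deriv f 0 * x" by eventually_elim (use lin in auto)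
  from nicely_meromorphic_eq_linear[OF assms(2) open_ball connected_ball _ this]
  show ?thesis by (auto simp: sphere_map_def)
qed

end
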